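(* Let $G$ be a metrizable topological group with a dense subgroup $H$. For each precompact set $K\subseteq G$ there is a precompact set $J\subseteq H$ such that $K\subseteq\overline{J}$.
   Context: A subset $A$ of a topological group $G$ is precompact if for each neighborhood $U$ of the identity there is a finite $F\subseteq G$ with $A\subseteq FU$. $\overline{J}$ is the closure of $J$ in $G$. Groups are not assumed abelian. *)

theory Defs
  imports "HOL-Analysis.Analysis" "HOL-Algebra.Coset"
begin

locale topological_group = group G for G (structure) +
  fixes T :: "'a topology"
  assumes topspace_eq_carrier: "topspace T = carrier G"
    and continuous_mult: "continuous_map (prod_topology T T) T (\<lambda>(x, y). x \<otimes> y)"
    and continuous_inv: "continuous_map T T (\<lambda>x. inv x)"

text \<open>Neighborhoods need not be open.\<close>

definition neighborhood_in :: "'a topology \<Rightarrow> 'a \<Rightarrow> 'a set \<Rightarrow> bool" where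
  "neighborhood_in T x U \<longleftrightarrow>
     U \<subseteq> topspace T \<and> (\<exists>V. openin T V \<and> x \<in> V \<and> V \<subseteq> U)"

text \<open>The translating set \<open>F\<close> is taken in the ambient group \<open>G\<close>, also when \<open>A\<close> lies in a
  subgroup; \<open>F <#>\<^bsub>G\<^esub> U\<close> is the product set \<open>FU\<close> (left translates of \<open>U\<close>).\<close>

definition precompact_in :: "('a, 'b) monoid_scheme \<Rightarrow> 'a topology \<Rightarrow> 'a set \<Rightarrow> bool" where
  "precompact_in G T A \<longleftrightarrow>
     A \<subseteq> carrier G \<and>
     (\<forall>U. neighborhood_in T \<one>\<^bsub>G\<^esub> U \<longrightarrow>
        (\<exists>F. finite F \<and> F \<subseteq> carrier G \<and> A \<subseteq> F <#>\<^bsub>G\<^esub> U))"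

end

theory Submission
  imports Defs
begin

text \<open>Let \<open>U\<^sub>n\<close> be the ball of radius \<open>1/(n+1)\<close> about the identity. Covering \<open>K\<close> by finitely many
  small left translates and choosing a point of \<open>H\<close> in each translate that meets \<open>K\<close> gives a
  finite \<open>J\<^sub>n \<subseteq> H\<close> such that \<open>J\<^sub>n \<subseteq> K U\<^sub>n\<close> and every \<open>k U\<^sub>n\<close> with \<open>k \<in> K\<close> meets \<open>J\<^sub>n\<close>. The union \<open>J\<close>
  of all \<open>J\<^sub>n\<close> accumulates at every point of \<open>K\<close>. It is precompact because all but finitely many
  of its points lie in \<open>K W\<close>, for any given neighborhood \<open>W\<close> of the identity.\<close>

lemma precompact_inD:
  assumes "precompact_in G T A" "openin T V" "\<one>\<^bsub>G\<^esub> \<in> V"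
  obtains F where "finite F" "F \<subseteq> carrier G" "A \<subseteq> F <#>\<^bsub>G\<^esub> V"
proof -
  have "neighborhood_in T \<one>\<^bsub>G\<^esub> V"
    unfolding neighborhood_in_def using assms(2,3) openin_subset by blast
  then show thesis
    using assms(1) that unfolding precompact_in_def by blast
qed

text \<open>Every neighborhood contains an open one, and \<open>F <#> V\<close> grows with
  \<open>V\<close>; so open neighborhoods of the identity are enough to test.\<close>

lemma precompact_inI:
  assumes "A \<subseteq> carrier G"
    and "\<And>V. openin T V \<Longrightarrow> \<one>\<^bsub>G\<^esub> \<in> V \<Longrightarrow> \<exists>F. finite F \<and> F \<subseteq> carrier G \<and> A \<subseteq> F <#>\<^bsub>G\<^esub> V"
  shows "precompact_in G T A"
  unfolding precompact_in_def
proof (intro conjI allI impI assms(1))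
  fix U assume "neighborhood_in T \<one>\<^bsub>G\<^esub> U"
  then obtain V where V: "openin T V" "\<one>\<^bsub>G\<^esub> \<in> V" "V \<subseteq> U"
    unfolding neighborhood_in_def by blast
  obtain F where "finite F" "F \<subseteq> carrier G" "A \<subseteq> F <#>\<^bsub>G\<^esub> V"
    using assms(2)[OF V(1,2)] by (elim exE conjE)
  moreover have "F <#>\<^bsub>G\<^esub> V \<subseteq> F <#>\<^bsub>G\<^esub> U"
    using V(3) unfolding set_mult_def by blast
  ultimately show "\<exists>F. finite F \<and> F \<subseteq> carrier G \<and> A \<subseteq> F <#>\<^bsub>G\<^esub> U"
    by blast
qed

context topological_group
begin

lemma continuous_map_mult:
  assumes "continuous_map X T f" "continuous_map X T g"
  shows "continuous_map X T (\<lambda>x. f x \<otimes> g x)"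
  using continuous_map_compose[OF continuous_map_pairedI[OF assms] continuous_mult]
  by (simp add: o_def)

text \<open>The set is the translate of \<open>V\<close> by \<open>inv a\<close>. It is used with
  \<open>inv f\<close> for \<open>a\<close> to get an open neighborhood of \<open>f\<close>, and
  with \<open>k\<close> for \<open>a\<close> to pull a neighborhood of \<open>k\<close> back to the
  identity.\<close>

lemma openin_left_translate_preimage:
  assumes "a \<in> carrier G" "openin T V"
  shows "openin T {x \<in> carrier G. a \<otimes> x \<in> V}"
proof -
  have "continuous_map T T (\<lambda>x. a \<otimes> x)"
    by (rule continuous_map_mult) (simp_all add: assms(1) topspace_eq_carrier)
  from openin_continuous_map_preimage[OF this assms(2)] show ?thesis
    by (simp add: topspace_eq_carrier)
qed

text \<open>Continuity at the pair of identities gives a box inside the preimage of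
  \<open>U\<close>; intersecting its two sides gives one \<open>V\<close> for both
  arguments.\<close>

lemma nbhd_identity_binary:
  assumes f: "continuous_map (prod_topology T T) T (\<lambda>(x, y). f x y)" and "f \<one> \<one> = \<one>"
    and U: "openin T U" "\<one> \<in> U"
  obtains V where "openin T V" "\<one> \<in> V" "\<And>x y. x \<in> V \<Longrightarrow> y \<in> V \<Longrightarrow> f x y \<in> U"
proof -
  define P where "P = {p \<in> topspace (prod_topology T T). (\<lambda>(x, y). f x y) p \<in> U}"
  have "openin (prod_topology T T) P"
    unfolding P_def by (rule openin_continuous_map_preimage[OF f U(1)])
  moreover have "(\<one>, \<one>) \<in> P"
    by (simp add: P_def assms(2) U(2) topspace_eq_carrier)
  ultimately have "\<exists>A B. openin T A \<and> openin T B \<and> \<one> \<in> A \<and> \<one> \<in> B \<and> A \<times> B \<subseteq> P"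
    by (rule openin_prod_topology_alt[THEN iffD1, rule_format])
  then obtain A B where AB: "openin T A" "openin T B" "\<one> \<in> A" "\<one> \<in> B" "A \<times> B \<subseteq> P"
    by (elim exE conjE)
  show thesis
  proof
    show "openin T (A \<inter> B)" using AB(1,2) by (rule openin_Int)
    show "\<one> \<in> A \<inter> B" using AB(3,4) by simp
    show "f x y \<in> U" if "x \<in> A \<inter> B" "y \<in> A \<inter> B" for x y
    proof -
      have "(x, y) \<in> P" using AB(5) that by blast
      then show ?thesis by (simp add: P_def)
    qed
  qed
qed

text \<open>The approximation is two-sided: closeness of \<open>J\<close> to \<open>K\<close> will
  give precompactness of the union, and closeness of \<open>K\<close> to \<open>J\<close> will give
  density in \<open>K\<close>.\<close>

lemma precompact_finite_approx:
  assumes "subgroup H G" and dense: "T closure_of H = topspace T"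
    and K: "precompact_in G T K" and U: "openin T U" "\<one> \<in> U"
  obtains J where "finite J" "J \<subseteq> H"
    "\<And>h. h \<in> J \<Longrightarrow> \<exists>k\<in>K. inv k \<otimes> h \<in> U" "\<And>k. k \<in> K \<Longrightarrow> \<exists>h\<in>J. inv k \<otimes> h \<in> U"
proof -
  \<comment> \<open>Two points \<open>f \<otimes> v\<close> and \<open>f \<otimes> w\<close> of one
    left translate differ by \<open>inv v \<otimes> w\<close>, so \<open>V\<close> is chosen to keep
    this quotient in \<open>U\<close>.\<close>
  have "continuous_map (prod_topology T T) T (\<lambda>(v, w). inv v \<otimes> w)"
    using continuous_map_mult[OF continuous_map_compose[OF continuous_map_fst continuous_inv]
        continuous_map_snd] by (simp add: o_def case_prod_unfold)
  then obtain V where V: "openin T V" "\<one> \<in> V"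
    and VU: "\<And>v w. v \<in> V \<Longrightarrow> w \<in> V \<Longrightarrow> inv v \<otimes> w \<in> U"
    using nbhd_identity_binary[OF _ _ U, of "\<lambda>v w. inv v \<otimes> w"] by auto
  have VG: "V \<subseteq> carrier G"
    using V(1) openin_subset topspace_eq_carrier by metis
  obtain F where F: "finite F" "F \<subseteq> carrier G" "K \<subseteq> F <#> V"
    using precompact_inD[OF K V] .
  have "\<exists>h\<in>H. inv f \<otimes> h \<in> V" if f: "f \<in> F" for f
  proof -
    have fG: "f \<in> carrier G" using f F(2) by blast
    have "f \<in> T closure_of H" by (simp add: dense topspace_eq_carrier fG)
    then have meets: "\<And>S. f \<in> S \<Longrightarrow> openin T S \<Longrightarrow> \<exists>y. y \<in> H \<and> y \<in> S"
      by (simp add: in_closure_of)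
    \<comment> \<open>This set is the translate of \<open>V\<close> by \<open>f\<close>, an open
      neighborhood of \<open>f\<close>, so the dense \<open>H\<close> meets it.\<close>
    have "\<exists>y. y \<in> H \<and> y \<in> {x \<in> carrier G. inv f \<otimes> x \<in> V}"
    proof (rule meets)
      show "f \<in> {x \<in> carrier G. inv f \<otimes> x \<in> V}" using fG V(2) by simp
      show "openin T {x \<in> carrier G. inv f \<otimes> x \<in> V}"
        using openin_left_translate_preimage[OF _ V(1)] fG by simp
    qed
    then show ?thesis by blast
  qed
  then obtain h where h: "\<And>f. f \<in> F \<Longrightarrow> h f \<in> H \<and> inv f \<otimes> h f \<in> V"
    by metis
  have approx: "inv (f \<otimes> v) \<otimes> h f \<in> U" if "f \<in> F" "v \<in> V" for f v
  proof -
    have "f \<in> carrier G" "v \<in> carrier G" using that F(2) VG by blast+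
    moreover have "h f \<in> carrier G"
      using h[OF that(1)] subgroup.mem_carrier[OF assms(1)] by blast
    ultimately have "inv (f \<otimes> v) \<otimes> h f = inv v \<otimes> (inv f \<otimes> h f)"
      by (simp add: inv_mult_group m_assoc)
    then show ?thesis using VU h that by simp
  qed
  show thesis
  proof
    \<comment> \<open>Only translates that meet \<open>K\<close> are kept: the point chosen in any
      other translate could be far from \<open>K\<close>.\<close>
    let ?J = "h ` {f \<in> F. \<exists>v\<in>V. f \<otimes> v \<in> K}"
    show "finite ?J" using F(1) by simp
    show "?J \<subseteq> H" using h by blast
    show "\<exists>k\<in>K. inv k \<otimes> x \<in> U" if "x \<in> ?J" for x using that approx by blast
    show "\<exists>x\<in>?J. inv k \<otimes> x \<in> U" if k: "k \<in> K" for k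
    proof -
      obtain f v where "f \<in> F" "v \<in> V" "k = f \<otimes> v"
        using k F(3) unfolding set_mult_def by blast
      then show ?thesis using approx k by blast
    qed
  qed
qed

text \<open>Metrizability enters the argument only through this countable decreasing base at the
  identity, made of balls.\<close>

lemma metrizable_decseq_base:
  assumes "metrizable_space T"
  obtains U :: "nat \<Rightarrow> 'a set" where "\<And>n. openin T (U n)" "\<And>n. \<one> \<in> U n" "decseq U"
    "\<And>V. openin T V \<Longrightarrow> \<one> \<in> V \<Longrightarrow> \<exists>n. U n \<subseteq> V"
proof -
  obtain M d where Md: "Metric_space M d" "T = Metric_space.mtopology M d"
    using assms unfolding metrizable_space_def by blast
  interpret Metric_space M d by (rule Md(1))
  have one: "\<one> \<in> M"
    using topspace_eq_carrier Md(2) by simp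
  show thesis
  proof
    let ?U = "\<lambda>n. mball \<one> (inverse (real (Suc n)))"
    show "openin T (?U n)" for n using Md(2) by simp
    show "\<one> \<in> ?U n" for n using one by simp
    show "decseq ?U"
      by (intro antimonoI mball_subset_concentric) (simp add: field_simps)
    fix V assume "openin T V" "\<one> \<in> V"
    then have "\<exists>r>0. mball \<one> r \<subseteq> V"
      unfolding Md(2) openin_mtopology by simp
    then obtain r where r: "r > 0" "mball \<one> r \<subseteq> V"
      by blast
    then obtain n where "inverse (real (Suc n)) < r"
      using reals_Archimedean by blast
    then have "?U n \<subseteq> mball \<one> r" by (intro mball_subset_concentric) simp
    then show "\<exists>n. ?U n \<subseteq> V" using r(2) by blast
  qed
qed

lemma precompact_subset_closure_of_dense_subgroup:
  assumes "metrizable_space T" "subgroup H G" "T closure_of H = topspace T"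
    and K: "precompact_in G T K"
  shows "\<exists>J. J \<subseteq> H \<and> precompact_in G T J \<and> K \<subseteq> T closure_of J"
proof -
  have KG: "K \<subseteq> carrier G" using K unfolding precompact_in_def by blast
  have HG: "H \<subseteq> carrier G" using assms(2) by (rule subgroup.subset)
  obtain U :: "nat \<Rightarrow> 'a set" where U: "\<And>n. openin T (U n)" "\<And>n. \<one> \<in> U n" "decseq U"
    and base: "\<And>V. openin T V \<Longrightarrow> \<one> \<in> V \<Longrightarrow> \<exists>n. U n \<subseteq> V"
    using metrizable_decseq_base[OF assms(1)] by blast
  have "\<exists>J. finite J \<and> J \<subseteq> H \<and> (\<forall>h\<in>J. \<exists>k\<in>K. inv k \<otimes> h \<in> U n) \<and> (\<forall>k\<in>K. \<exists>h\<in>J. inv k \<otimes> h \<in> U n)"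
    for n using precompact_finite_approx[OF assms(2,3) K U(1,2)] by metis
  then obtain J where J: "\<And>n. finite (J n)" "\<And>n. J n \<subseteq> H"
    and JK: "\<And>n h. h \<in> J n \<Longrightarrow> \<exists>k\<in>K. inv k \<otimes> h \<in> U n"
    and KJ: "\<And>n k. k \<in> K \<Longrightarrow> \<exists>h\<in>J n. inv k \<otimes> h \<in> U n"
    by metis
  show ?thesis
  proof (intro exI conjI)
    show JH: "(\<Union>n. J n) \<subseteq> H" using J(2) by blast
    show "precompact_in G T (\<Union>n. J n)"
    proof (rule precompact_inI)
      show "(\<Union>n. J n) \<subseteq> carrier G" using JH HG by blast
      fix V assume V: "openin T V" "\<one> \<in> V"
      \<comment> \<open>One factor from \<open>W\<close> is spent on passing from \<open>F\<close>
        to \<open>K\<close>, the other on passing from \<open>K\<close> to a late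
        \<open>J m\<close>.\<close>
      obtain W where W: "openin T W" "\<one> \<in> W" and WV: "\<And>x y. x \<in> W \<Longrightarrow> y \<in> W \<Longrightarrow> x \<otimes> y \<in> V"
        using nbhd_identity_binary[OF continuous_mult _ V] by auto
      have WG: "W \<subseteq> carrier G" using W(1) openin_subset topspace_eq_carrier by metis
      obtain F where F: "finite F" "F \<subseteq> carrier G" "K \<subseteq> F <#> W"
        using precompact_inD[OF K W] .
      obtain n where n: "U n \<subseteq> W" using base W by blast
      \<comment> \<open>The stages before \<open>n\<close> have finitely many points altogether, so
        these serve as translating elements themselves.\<close>
      let ?E = "\<Union>m<n. J m"
      have "h \<in> (F \<union> ?E) <#> V" if h: "h \<in> J m" for h m
      proof (cases "m < n")
        case True
        then have "h \<in> F \<union> ?E" using h by blast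
        moreover have "h = h \<otimes> \<one>" using h J(2) HG by (metis r_one subsetD)
        ultimately show ?thesis using V(2) unfolding set_mult_def by blast
      next
        case False
        obtain k where k: "k \<in> K" "inv k \<otimes> h \<in> U m" using JK h by blast
        \<comment> \<open>As the base decreases, the single index \<open>n\<close> handles all later
          stages: \<open>U m \<subseteq> U n \<subseteq> W\<close>.\<close>
        then have kW: "inv k \<otimes> h \<in> W"
          using False n decseqD[OF U(3), of n m] by auto
        obtain f w where fw: "f \<in> F" "w \<in> W" "k = f \<otimes> w"
          using k(1) F(3) unfolding set_mult_def by blast
        have G: "f \<in> carrier G" "w \<in> carrier G" "k \<in> carrier G" "h \<in> carrier G"
          using fw(1,2) F(2) WG k(1) KG h J(2) HG by blast+
        have "h = k \<otimes> (inv k \<otimes> h)" using G by (simp add: m_assoc[symmetric])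
        also have "\<dots> = f \<otimes> (w \<otimes> (inv k \<otimes> h))" using G fw(3) by (simp add: m_assoc)
        finally show ?thesis
          using fw(1) WV[OF fw(2) kW] unfolding set_mult_def by blast
      qed
      then have "(\<Union>n. J n) \<subseteq> (F \<union> ?E) <#> V" by blast
      moreover have "finite (F \<union> ?E)" using F(1) J(1) by simp
      moreover have "F \<union> ?E \<subseteq> carrier G" using F(2) J(2) HG by blast
      ultimately show "\<exists>F. finite F \<and> F \<subseteq> carrier G \<and> (\<Union>n. J n) \<subseteq> F <#> V" by blast
    qed
    show "K \<subseteq> T closure_of (\<Union>n. J n)"
    proof
      fix k assume k: "k \<in> K"
      then have kG: "k \<in> carrier G" using KG by blast
      have "\<exists>h. h \<in> (\<Union>n. J n) \<and> h \<in> V" if V: "k \<in> V" "openin T V" for V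
      proof -
        \<comment> \<open>Translated back to the identity, \<open>V\<close> contains some
          \<open>U n\<close>; the point of \<open>J n\<close> that approximates \<open>k\<close> up
          to \<open>U n\<close> then lies in \<open>V\<close>.\<close>
        obtain n where n: "U n \<subseteq> {x \<in> carrier G. k \<otimes> x \<in> V}"
          using base[OF openin_left_translate_preimage[OF kG V(2)]] kG V(1) by auto
        obtain h where h: "h \<in> J n" "inv k \<otimes> h \<in> U n" using KJ k by blast
        have "h \<in> carrier G" using h(1) J(2) HG by blast
        then have "k \<otimes> (inv k \<otimes> h) = h"
          using kG by (simp add: m_assoc[symmetric])
        moreover have "k \<otimes> (inv k \<otimes> h) \<in> V" using n h(2) by blast
        ultimately have "h \<in> V" by simp
        with h(1) show ?thesis by blast
      qed
      then show "k \<in> T closure_of (\<Union>n. J n)"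
        unfolding in_closure_of by (simp add: kG topspace_eq_carrier)
    qed
  qed
qed

end

theorem corollary3p19:
  fixes G :: "('a, 'b) monoid_scheme" and T :: "'a topology" and H K :: "'a set"
  assumes "topological_group G T"
    and "metrizable_space T"
    and "subgroup H G"
    and "T closure_of H = topspace T"
    and "precompact_in G T K"
  shows "\<exists>J. J \<subseteq> H \<and> precompact_in G T J \<and> K \<subseteq> T closure_of J"
  using topological_group.precompact_subset_closure_of_dense_subgroup[OF assms] .

end
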